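(* Suppose that for each $j=1,\dots,\ell$ the utility function $u_j:\mathbb{R}_+^k\to\mathbb{R}$ is homogeneous of degree $\beta_j>0$ and that $(u_j(q_j))^{1/\beta_j}$ is concave in $q_j$ and satisfies $$\big(u_j((1-\lambda_j)\tilde q_j+\lambda_j\hat q_j)\big)^{1/\beta_j}>(1-\lambda_j)\,(u_j(\tilde q_j))^{1/\beta_j}+\lambda_j\,(u_j(\hat q_j))^{1/\beta_j}$$ for each $\lambda_j\in(0,1)$ and any non-collinear $\tilde q_j,\hat q_j\in\mathbb{R}_+^k$. Then for any $G\in\Omega(\bar q)$, $\mathcal V(G)>0$ if and only if $\mathcal F_G\neq\{\bar q\}$.
   Context: Notation: $\mathbb{R}_+^k$ and $\mathbb{R}_{++}^k$ are the vectors in $\mathbb{R}^k$ with all coordinates $\ge 0$, respectively $>0$. Economy. $X\subset\mathbb{R}^m$ is compact and convex. There are $k$ goods, good $i$ being supplied at a point $x_i\in X$, and $\ell$ consumers, consumer $j$ being located at $y_j\in X$ (all these points distinct). Consumer $j$ has a utility function $u_j:\mathbb{R}_+^k\to\mathbb{R}$ that is continuous, concave and increasing ($u_j(q')>u_j(q)$ whenever $q'_i>q_i$ for all $i$), a wealth $w_j>0$ and a price vector $p_j=(p_{1j},\dots,p_{kj})\in\mathbb{R}_{++}^k$. Fix for each $j$ a maximizer $\bar q_j=(\bar q_{1j},\dots,\bar q_{kj})$ of $u_j(q_j)$ over $\{q_j\in\mathbb{R}_+^k: p_j\cdot q_j\le w_j\}$, and let $\bar q=(\bar q_{ij})_{k\times\ell}$,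 normalized so that $\sum_{i,j}\bar q_{ij}=1$. Put $m_i=\sum_j\bar q_{ij}$, $n_j=\sum_i\bar q_{ij}$ (all positive), $\mathbf a=\sum_i m_i\delta_{x_i}$, $\mathbf b=\sum_j n_j\delta_{y_j}$. $\mathcal P(X\times X)$ denotes probability measures $q=\sum_{i,j}q_{ij}\delta_{(x_i,y_j)}$, identified with nonnegative $k\times\ell$ matrices of total sum 1; $q_j=(q_{1j},\dots,q_{kj})$ is the $j$-th column. Transport paths. A transport path $G$ from $\mathbf a$ to $\mathbf b$ is a finite weighted directed graph with vertex set $V(G)\subset X$ containing all $x_i,y_j$, directed edges $e\in E(G)$ which are line segments from $e^-$ to $e^+$, and weights $w(e)>0$, such that for every vertex $v$, $\sum_{e^-=v}w(e)=\sum_{e^+=v}w(e)+c_v$, where $c_v=m_i$ if $v=x_i$, $c_v=-n_j$ if $v=y_j$, and $c_v=0$ otherwise. It is assumed that for each $(i,j)$ there is at most one directed curve $g_{ij}$ from $x_i$ to $y_j$ in $G$, i.e. at most one list of distinct vertices starting at $x_i$ and ending at $y_j$ whose consecutive members are joined by directed edges of $G$; $e\subseteq g_{ij}$ means that the edge $e$ lies on this curve. A matrix $q\in\mathcal P(X\times X)$ is compatible with $G$ if $q_{ij}=0$ whenever $g_{ij}$ does not exist and $\sum_{(i,j):e\subseteq g_{ij}}q_{ij}=w(e)$ for every $e\in E(G)$. $\Omega(\bar q)$ is the set of transport paths $G$ from $\mathbf a$ to $\mathbf b$ with which $\bar q$ is compatible. Exchange value. $S(q)=\sum_{j=1}^\ell\min\{p_j\cdot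 t_j: t_j\in\mathbb{R}_+^k,\ u_j(t_j)\ge u_j(q_j)\}$. For $G\in\Omega(\bar q)$, $\mathcal F_G$ is the set of $q\in\mathcal P(X\times X)$ compatible with $G$ with $u_j(q_j)\ge u_j(\bar q_j)$ for all $j$, and $\mathcal V(G)=\max_{q\in\mathcal F_G}S(q)-S(\bar q)$. *)

theory Defs
  imports
    "HOL-Analysis.Analysis"
    "Graph_Theory.Pair_Digraph"
    "Graph_Theory.Vertex_Walk"
begin

text \<open>
  Goods are indexed by a finite type \<open>'k\<close>, consumers by a finite type \<open>'l\<close>, and the ambient
  space is \<open>real^'m\<close>.  A measure on pairs \<open>(x i, y j)\<close> is identified with its \<open>k \<times> l\<close> matrix,
  of type \<open>real^'l^'k\<close>: the entry \<open>q_ij\<close> is \<open>q $ i $ j\<close>, and the bundle \<open>q_j\<close> of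
  consumer \<open>j\<close> is \<open>column j q\<close>.
\<close>

definition orthant :: "(real^'k) set" where
  "orthant = {q. \<forall>i. 0 \<le> q $ i}"

definition prob_matrix :: "real^'l^'k \<Rightarrow> bool" where
  "prob_matrix q \<longleftrightarrow> (\<forall>i j. 0 \<le> q $ i $ j) \<and> (\<Sum>i\<in>UNIV. \<Sum>j\<in>UNIV. q $ i $ j) = 1"

definition row_mass :: "real^'l^'k \<Rightarrow> 'k \<Rightarrow> real" where
  "row_mass q i = (\<Sum>j\<in>UNIV. q $ i $ j)"

definition col_mass :: "real^'l^'k \<Rightarrow> 'l \<Rightarrow> real" where
  "col_mass q j = (\<Sum>i\<in>UNIV. q $ i $ j)"

text \<open>Utilities are total functions here; only their values on the orthant are constrained.\<close>

locale economy =
  fixes X :: "(real^'m) set"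
    and x :: "'k::finite \<Rightarrow> real^'m"
    and y :: "'l::finite \<Rightarrow> real^'m"
    and u :: "'l \<Rightarrow> real^'k \<Rightarrow> real"
    and w :: "'l \<Rightarrow> real"
    and p :: "'l \<Rightarrow> real^'k"
    and qbar :: "real^'l^'k"
  assumes compact_X: "compact X" and convex_X: "convex X"
    and x_in_X: "x i \<in> X" and y_in_X: "y j \<in> X"
    and inj_x: "inj x" and inj_y: "inj y" and x_neq_y: "x i \<noteq> y j"
    and u_continuous: "continuous_on orthant (u j)"
    and u_concave: "concave_on orthant (u j)"
    and u_increasing: "q \<in> orthant \<Longrightarrow> q' \<in> orthant \<Longrightarrow> (\<And>i. q $ i < q' $ i) \<Longrightarrow> u j q < u j q'"
    and wealth_pos: "0 < w j"
    and price_pos: "0 < p j $ i"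
    and qbar_optimal: "is_arg_max (u j) (\<lambda>q. q \<in> orthant \<and> p j \<bullet> q \<le> w j) (column j qbar)"
    and qbar_total: "(\<Sum>i\<in>UNIV. \<Sum>j\<in>UNIV. qbar $ i $ j) = 1"
    and row_mass_pos: "0 < row_mass qbar i"
    and col_mass_pos: "0 < col_mass qbar j"

text \<open>
  A line segment is determined by its end points, so edges are pairs and parallel edges do not
  occur; \<open>pair_digraph\<close> says that vertex and edge sets are finite, that edges join
  vertices, and that no edge degenerates to a point.  Weights are irrelevant off the edge set.
\<close>

definition curves :: "'v pair_pre_digraph \<Rightarrow> 'v \<Rightarrow> 'v \<Rightarrow> 'v list set" where
  "curves G a b = {c. vpath c (with_proj G) \<and> hd c = a \<and> last c = b}"

definition transport_path ::
  "(real^'m) set \<Rightarrow> ('k::finite \<Rightarrow> real^'m) \<Rightarrow> ('k \<Rightarrow> real) \<Rightarrow> ('l::finite \<Rightarrow> real^'m) \<Rightarrow> ('l \<Rightarrow> real)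
    \<Rightarrow> (real^'m) pair_pre_digraph \<Rightarrow> ((real^'m) \<times> (real^'m) \<Rightarrow> real) \<Rightarrow> bool" where
  "transport_path X x m y n G \<omega> \<longleftrightarrow>
     pair_digraph G \<and> pverts G \<subseteq> X \<and> range x \<subseteq> pverts G \<and> range y \<subseteq> pverts G \<and>
     (\<forall>e\<in>parcs G. 0 < \<omega> e) \<and>
     (\<forall>i. sum \<omega> (out_arcs G (x i)) = sum \<omega> (in_arcs G (x i)) + m i) \<and>
     (\<forall>j. sum \<omega> (out_arcs G (y j)) = sum \<omega> (in_arcs G (y j)) - n j) \<and>
     (\<forall>v\<in>pverts G - (range x \<union> range y). sum \<omega> (out_arcs G v) = sum \<omega> (in_arcs G v)) \<and>
     (\<forall>i j. \<forall>c\<in>curves G (x i) (y j). \<forall>c'\<in>curves G (x i) (y j). c = c')"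

text \<open>As there is at most one curve from \<open>x i\<close> to \<open>y j\<close>, the existential quantifier in the
  index set of the sum says that \<open>e\<close> lies on it.\<close>

definition compatible ::
  "('k::finite \<Rightarrow> 'v) \<Rightarrow> ('l::finite \<Rightarrow> 'v) \<Rightarrow> 'v pair_pre_digraph \<Rightarrow> ('v \<times> 'v \<Rightarrow> real)
    \<Rightarrow> real^'l^'k \<Rightarrow> bool" where
  "compatible x y G \<omega> q \<longleftrightarrow>
     (\<forall>i j. curves G (x i) (y j) = {} \<longrightarrow> q $ i $ j = 0) \<and>
     (\<forall>e\<in>parcs G.
        (\<Sum>(i, j)\<in>{(i, j). \<exists>c\<in>curves G (x i) (y j). e \<in> set (vwalk_arcs c)}. q $ i $ j) = \<omega> e)"

definition transport_paths ::
  "(real^'m) set \<Rightarrow> ('k::finite \<Rightarrow> real^'m) \<Rightarrow> ('l::finite \<Rightarrow> real^'m) \<Rightarrow> real^'l^'k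
    \<Rightarrow> ((real^'m) pair_pre_digraph \<times> ((real^'m) \<times> (real^'m) \<Rightarrow> real)) set" where
  "transport_paths X x y q =
     {(G, \<omega>). transport_path X x (row_mass q) y (col_mass q) G \<omega> \<and> compatible x y G \<omega> q}"

text \<open>\<open>LEAST\<close> and \<open>GREATEST\<close> denote an attained minimum and maximum; they are not
  infimum and supremum.\<close>

definition expenditure :: "(real^'k \<Rightarrow> real) \<Rightarrow> real^'k \<Rightarrow> real^'k \<Rightarrow> real" where
  "expenditure u p q = (LEAST v. \<exists>t\<in>orthant. u q \<le> u t \<and> v = p \<bullet> t)"

definition total_expenditure ::
  "('l::finite \<Rightarrow> real^'k \<Rightarrow> real) \<Rightarrow> ('l \<Rightarrow> real^'k) \<Rightarrow> real^'l^'k \<Rightarrow> real" where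
  "total_expenditure u p q = (\<Sum>j\<in>UNIV. expenditure (u j) (p j) (column j q))"

definition feasible_plans ::
  "('k::finite \<Rightarrow> 'v) \<Rightarrow> ('l::finite \<Rightarrow> 'v) \<Rightarrow> ('l \<Rightarrow> real^'k \<Rightarrow> real) \<Rightarrow> real^'l^'k
    \<Rightarrow> 'v pair_pre_digraph \<Rightarrow> ('v \<times> 'v \<Rightarrow> real) \<Rightarrow> (real^'l^'k) set" where
  "feasible_plans x y u qbar G \<omega> =
     {q. prob_matrix q \<and> compatible x y G \<omega> q \<and> (\<forall>j. u j (column j qbar) \<le> u j (column j q))}"

definition exchange_value ::
  "('k::finite \<Rightarrow> 'v) \<Rightarrow> ('l::finite \<Rightarrow> 'v) \<Rightarrow> ('l \<Rightarrow> real^'k \<Rightarrow> real) \<Rightarrow> ('l \<Rightarrow> real^'k)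
    \<Rightarrow> real^'l^'k \<Rightarrow> 'v pair_pre_digraph \<Rightarrow> ('v \<times> 'v \<Rightarrow> real) \<Rightarrow> real" where
  "exchange_value x y u p qbar G \<omega> =
     (GREATEST s. \<exists>q\<in>feasible_plans x y u qbar G \<omega>. s = total_expenditure u p q)
       - total_expenditure u p qbar"

definition homogeneous :: "real \<Rightarrow> (real^'k \<Rightarrow> real) \<Rightarrow> bool" where
  "homogeneous \<beta> f \<longleftrightarrow> (\<forall>q\<in>orthant. \<forall>s>0. f (s *\<^sub>R q) = s powr \<beta> * f q)"

end

theory Submission
  imports Defs
begin

text \<open>
  By homogeneity the expenditure function of consumer \<open>j\<close> is
  \<open>w j * (u j q / u j (column j qbar)) powr (1 / \<beta> j)\<close>.  So on feasible plans the total
  expenditure is continuous, at least its value at \<open>qbar\<close>, and equal to it only if every consumer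
  keeps the utility of \<open>qbar\<close>.  Feasible plans form a compact convex set, so the maximum is
  attained.  If a feasible \<open>q \<noteq> qbar\<close> gives everybody exactly the utility of \<open>qbar\<close>, then a
  column of \<open>q\<close> that differs from that of \<open>qbar\<close> is not even proportional to it, by homogeneity,
  and strict concavity makes the midpoint of \<open>q\<close> and \<open>qbar\<close> a strict improvement for that
  consumer.
\<close>

section \<open>Expenditure functions of homogeneous utilities\<close>

lemma column_in_orthant: "prob_matrix q \<Longrightarrow> column j q \<in> orthant"
  by (simp add: prob_matrix_def orthant_def column_def)

text \<open>Homogeneity only speaks of positive factors, so the value at the origin comes from
  \<open>2 *\<^sub>R 0 = 0\<close> and not from the factor 0.\<close>

lemma homogeneous_zero:
  fixes f :: "real^'k \<Rightarrow> real"
  assumes "homogeneous \<beta> f" "0 < \<beta>"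
  shows "f 0 = 0"
proof -
  have "0 \<in> (orthant :: (real^'k) set)"
    by (simp add: orthant_def)
  then have "f (2 *\<^sub>R 0) = 2 powr \<beta> * f 0"
    using assms(1) unfolding homogeneous_def by (metis zero_less_numeral)
  moreover have "2 powr \<beta> \<noteq> (1::real)"
    using assms(2) by simp
  ultimately show ?thesis
    by simp
qed

text \<open>Scaling by a suitable \<open>s\<close> carries the bundles at least as good as
  \<open>t0\<close> onto those at least as good as \<open>q\<close> and multiplies every cost by
  \<open>s\<close>, so it carries a cheapest bundle to a cheapest bundle.\<close>

lemma expenditure_homogeneous:
  assumes hom: "homogeneous \<beta> f" and \<beta>: "0 < \<beta>"
    and t0: "t0 \<in> orthant" "0 < f t0"
    and cheapest: "\<And>t. t \<in> orthant \<Longrightarrow> f t0 \<le> f t \<Longrightarrow> p \<bullet> t0 \<le> p \<bullet> t"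
    and q: "0 < f q"
  shows "expenditure f p q = (p \<bullet> t0) * (f q / f t0) powr (1 / \<beta>)"
proof -
  \<comment> \<open>The factor for which \<open>f (s *\<^sub>R t0) = f q\<close>.\<close>
  define s where "s = (f q / f t0) powr (1 / \<beta>)"
  have s: "0 < s" and s\<beta>: "s powr \<beta> = f q / f t0"
    using t0 q \<beta> by (auto simp: s_def powr_powr)
  have scale: "r *\<^sub>R t \<in> orthant" if "t \<in> orthant" "0 < r" for r and t :: "real^'a"
    using that by (simp add: orthant_def)
  have "s * (p \<bullet> t0) \<le> p \<bullet> t" if t: "t \<in> orthant" "f q \<le> f t" for t
  proof -
    \<comment> \<open>Shrinking a competitor of \<open>s *\<^sub>R t0\<close> gives a competitor of
      \<open>t0\<close>.\<close>
    have "f (inverse s *\<^sub>R t) = inverse s powr \<beta> * f t"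
      using hom t s unfolding homogeneous_def by (metis inverse_positive_iff_positive)
    also have "\<dots> = f t * (f t0 / f q)"
      using s s\<beta> by (simp add: inverse_powr)
    also have "\<dots> \<ge> f t0"
      using t t0 q by (simp add: field_simps)
    finally have "p \<bullet> t0 \<le> p \<bullet> (inverse s *\<^sub>R t)"
      using t s by (intro cheapest scale) auto
    then show ?thesis
      using s by (simp add: inverse_eq_divide le_divide_eq mult.commute)
  qed
  moreover have "f (s *\<^sub>R t0) = f q"
    using hom s t0 s\<beta> by (simp add: homogeneous_def)
  ultimately have "expenditure f p q = p \<bullet> (s *\<^sub>R t0)"
    unfolding expenditure_def
    using scale[OF t0(1) s]
    by (intro Least_equality bexI[of _ "s *\<^sub>R t0"]) auto
  then show ?thesis
    by (simp add: s_def mult.commute)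
qed

section \<open>Convexity, closedness and boundedness of the linear constraints on plans\<close>

lemma sum_matrix_affine:
  fixes q q' :: "real^'l^'k"
  shows "(\<Sum>(i, j)\<in>A. (a *\<^sub>R q + b *\<^sub>R q') $ i $ j) =
    a * (\<Sum>(i, j)\<in>A. q $ i $ j) + b * (\<Sum>(i, j)\<in>A. q' $ i $ j)"
  by (simp add: sum_distrib_left sum.distrib case_prod_unfold)

lemma convex_prob_matrix: "convex {q. prob_matrix q}"
  unfolding convex_def prob_matrix_def
  by (simp add: sum.distrib flip: sum_distrib_left)

lemma convex_compatible: "convex {q. compatible x y G \<omega> q}"
proof (rule convexI)
  fix q q' and a b :: real
  assume "q \<in> {q. compatible x y G \<omega> q}" "q' \<in> {q. compatible x y G \<omega> q}" "a + b = 1"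
  then show "a *\<^sub>R q + b *\<^sub>R q' \<in> {q. compatible x y G \<omega> q}"
    unfolding compatible_def mem_Collect_eq sum_matrix_affine by (simp flip: distrib_right)
qed

lemma closed_prob_matrix: "closed {q::real^'l^'k. prob_matrix q}"
  unfolding prob_matrix_def
  by (intro closed_Collect_conj closed_Collect_all closed_Collect_le closed_Collect_eq
      continuous_intros)

lemma closed_compatible: "closed {q. compatible x y G \<omega> q}"
  unfolding compatible_def case_prod_unfold Ball_def
  \<comment> \<open>The premises of the implications do not mention \<open>q\<close>, so each
    describes an open set, empty or everything.\<close>
  by (intro closed_Collect_conj closed_Collect_all closed_Collect_imp open_Collect_const
      closed_Collect_eq continuous_intros)

lemma bounded_prob_matrix: "bounded {q::real^'l^'k. prob_matrix q}"
proof (rule boundedI)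
  fix q :: "real^'l^'k"
  assume "q \<in> {q. prob_matrix q}"
  then have q: "\<And>i j. 0 \<le> q $ i $ j" "(\<Sum>i\<in>UNIV. \<Sum>j\<in>UNIV. q $ i $ j) = 1"
    by (auto simp: prob_matrix_def)
  have "norm q \<le> (\<Sum>i\<in>UNIV. norm (q $ i))"
    unfolding norm_vec_def by (simp add: L2_set_le_sum)
  also have "\<dots> \<le> (\<Sum>i\<in>UNIV. \<Sum>j\<in>UNIV. \<bar>q $ i $ j\<bar>)"
    by (intro sum_mono norm_le_l1_cart)
  also have "\<dots> = 1"
    using q by simp
  finally show "norm q \<le> 1" .
qed

lemma continuous_on_column: "continuous_on S (column j)"
  unfolding column_def by (intro continuous_intros)

section \<open>Budget duality at \<open>qbar\<close> and the geometry of feasible plans\<close>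

context economy
begin

lemma prob_matrix_qbar: "prob_matrix qbar"
  using qbar_optimal qbar_total
  by (auto simp: prob_matrix_def is_arg_max_def orthant_def column_def)

lemma continuous_on_utility: "continuous_on {q. prob_matrix q} (\<lambda>q. u j (column j q))"
  by (rule continuous_on_compose2[OF u_continuous continuous_on_column])
    (auto intro: column_in_orthant)

text \<open>Were \<open>t\<close> cheaper than the wealth, spending the rest on all goods at once
  would strictly raise utility within the budget, against the optimality of
  \<open>qbar\<close>.\<close>

lemma column_qbar_cheapest:
  assumes t: "t \<in> orthant" "u j (column j qbar) \<le> u j t"
  shows "w j \<le> p j \<bullet> t"
proof (rule ccontr)
  assume "\<not> w j \<le> p j \<bullet> t"
  then have gap: "0 < w j - p j \<bullet> t"
    by simp
  \<comment> \<open>The cost of one unit of every good; the leftover money buys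
    \<open>(w j - p j \<bullet> t) / P\<close> units of each.\<close>
  define P where "P = p j \<bullet> (1::real^'k)"
  have P: "0 < P"
    unfolding P_def inner_vec_def by (auto intro!: sum_pos price_pos)
  define t' where "t' = t + ((w j - p j \<bullet> t) / P) *\<^sub>R 1"
  have "p j \<bullet> t' = w j"
    using P by (simp add: t'_def inner_add_right flip: P_def)
  moreover have less: "t $ i < t' $ i" for i
    using gap P by (simp add: t'_def)
  moreover have "t' \<in> orthant"
    using t less unfolding orthant_def by (auto intro: order.trans[OF _ less_imp_le])
  ultimately show False
    using u_increasing[of t t' j] t qbar_optimal[of j]
    unfolding is_arg_max_def by (metis order.strict_trans1 order_refl)
qed

lemma cost_column_qbar: "p j \<bullet> column j qbar = w j"
  using column_qbar_cheapest[of "column j qbar" j] qbar_optimal[of j]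
  by (auto simp: is_arg_max_def)

text \<open>The zero bundle costs nothing, and whatever reaches the utility of \<open>qbar\<close>
  costs at least \<open>w j > 0\<close>.\<close>

lemma utility_zero_less: "u j 0 < u j (column j qbar)"
proof -
  have "0 \<in> (orthant :: (real^'k) set)"
    by (simp add: orthant_def)
  then show ?thesis
    using column_qbar_cheapest[of 0 j] wealth_pos[of j] by force
qed

lemma compact_feasible_plans: "compact (feasible_plans x y u qbar G \<omega>)"
proof -
  \<comment> \<open>\<open>prob_matrix\<close> is put inside the intersection because utilities are
    known to be continuous only there, so the preimages are closed relative to that closed
    set.\<close>
  have "feasible_plans x y u qbar G \<omega> = {q. compatible x y G \<omega> q} \<inter>
      (\<Inter>j. {q. prob_matrix q} \<inter> (\<lambda>q. u j (column j q)) -` {u j (column j qbar)..})"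
    by (auto simp: feasible_plans_def)
  moreover have "closed \<dots>"
    by (intro closed_Int closed_INT ballI closed_compatible
        continuous_closed_preimage continuous_on_utility closed_prob_matrix closed_atLeast)
  moreover have "bounded (feasible_plans x y u qbar G \<omega>)"
    by (rule bounded_subset[OF bounded_prob_matrix]) (auto simp: feasible_plans_def)
  ultimately show ?thesis
    by (simp add: compact_eq_bounded_closed)
qed

text \<open>Concavity of the utilities makes their upper level sets convex; the other constraints
  are linear.\<close>

lemma convex_feasible_plans: "convex (feasible_plans x y u qbar G \<omega>)"
proof (rule convexI)
  fix q q' and a b :: real
  assume q: "q \<in> feasible_plans x y u qbar G \<omega>" and q': "q' \<in> feasible_plans x y u qbar G \<omega>"
    and ab: "0 \<le> a" "0 \<le> b" "a + b = 1"
  have "u j (column j qbar) \<le> u j (column j (a *\<^sub>R q + b *\<^sub>R q'))" for j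
  proof -
    have "u j (column j qbar) = a * u j (column j qbar) + b * u j (column j qbar)"
      using ab by (simp flip: distrib_right)
    also have "\<dots> \<le> a * u j (column j q) + b * u j (column j q')"
      using q q' ab by (intro add_mono mult_left_mono) (auto simp: feasible_plans_def)
    also have "\<dots> \<le> u j (a *\<^sub>R column j q + b *\<^sub>R column j q')"
      using u_concave[of j] q q' ab
      by (auto simp: concave_on_iff feasible_plans_def intro: column_in_orthant)
    also have "a *\<^sub>R column j q + b *\<^sub>R column j q' = column j (a *\<^sub>R q + b *\<^sub>R q')"
      by (simp add: column_def vec_eq_iff)
    finally show ?thesis .
  qed
  moreover have "prob_matrix (a *\<^sub>R q + b *\<^sub>R q')"
    using convexD[OF convex_prob_matrix, of q q' a b] q q' ab by (simp add: feasible_plans_def)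
  moreover have "compatible x y G \<omega> (a *\<^sub>R q + b *\<^sub>R q')"
    using convexD[OF convex_compatible, of q x y G \<omega> q' a b] q q' ab
    by (simp add: feasible_plans_def)
  ultimately show "a *\<^sub>R q + b *\<^sub>R q' \<in> feasible_plans x y u qbar G \<omega>"
    by (simp add: feasible_plans_def)
qed

end

section \<open>Expenditure and exchange value under homogeneity\<close>

locale homogeneous_economy = economy X x y u w p qbar
  for X :: "(real^'m) set" and x :: "'k::finite \<Rightarrow> real^'m" and y :: "'l::finite \<Rightarrow> real^'m"
    and u w p qbar +
  fixes \<beta> :: "'l \<Rightarrow> real"
  assumes degree_pos: "0 < \<beta> j"
    and u_homogeneous: "homogeneous (\<beta> j) (u j)"
begin

lemma utility_qbar_pos: "0 < u j (column j qbar)"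
  using utility_zero_less[of j] homogeneous_zero[OF u_homogeneous degree_pos] by simp

lemma expenditure_eq:
  assumes "u j (column j qbar) \<le> u j q"
  shows "expenditure (u j) (p j) q = w j * (u j q / u j (column j qbar)) powr (1 / \<beta> j)"
  using expenditure_homogeneous[OF u_homogeneous degree_pos, of "column j qbar" j "p j" q]
    column_in_orthant[OF prob_matrix_qbar] utility_qbar_pos[of j] assms
  by (simp add: column_qbar_cheapest cost_column_qbar)

lemma expenditure_qbar: "expenditure (u j) (p j) (column j qbar) = w j"
  using utility_qbar_pos[of j] by (simp add: expenditure_eq)

lemma expenditure_ge:
  assumes "u j (column j qbar) \<le> u j q"
  shows "w j \<le> expenditure (u j) (p j) q"
  unfolding expenditure_eq[OF assms]
  using assms utility_qbar_pos[of j] wealth_pos[of j] degree_pos[of j]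
  by (simp add: ge_one_powr_ge_zero)

lemma expenditure_greater:
  assumes "u j (column j qbar) < u j q"
  shows "w j < expenditure (u j) (p j) q"
  unfolding expenditure_eq[OF less_imp_le[OF assms]]
  using assms utility_qbar_pos[of j] wealth_pos[of j] degree_pos[of j]
  by (simp add: gr_one_powr)

lemma total_expenditure_greater:
  assumes q: "q \<in> feasible_plans x y u qbar G \<omega>"
    and j: "u j (column j qbar) < u j (column j q)"
  shows "total_expenditure u p qbar < total_expenditure u p q"
  unfolding total_expenditure_def expenditure_qbar
  using q expenditure_greater[OF j]
  by (intro sum_strict_mono_ex1) (auto simp: feasible_plans_def intro: expenditure_ge)

text \<open>On feasible plans the explicit formula replaces the \<open>LEAST\<close>, and the base
  of \<open>powr\<close> stays positive.\<close>

lemma continuous_on_total_expenditure: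
  "continuous_on (feasible_plans x y u qbar G \<omega>) (total_expenditure u p)"
proof -
  have "continuous_on (feasible_plans x y u qbar G \<omega>) (\<lambda>q. u j (column j q))" for j
    by (rule continuous_on_subset[OF continuous_on_utility]) (auto simp: feasible_plans_def)
  moreover have "0 < u j (column j q)" if "q \<in> feasible_plans x y u qbar G \<omega>" for j q
    using that utility_qbar_pos[of j] by (auto simp: feasible_plans_def intro: less_le_trans)
  ultimately have "continuous_on (feasible_plans x y u qbar G \<omega>)
      (\<lambda>q. \<Sum>j\<in>UNIV. w j * (u j (column j q) / u j (column j qbar)) powr (1 / \<beta> j))"
    using utility_qbar_pos
    by (intro continuous_intros) (auto simp: less_imp_neq[symmetric])
  then show ?thesis
    by (rule continuous_on_cong[THEN iffD1, rotated -1])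
      (auto simp: total_expenditure_def feasible_plans_def expenditure_eq)
qed

text \<open>Compactness and continuity yield a maximizer, so the \<open>GREATEST\<close> is a
  genuine maximum and bounds every feasible plan.\<close>

lemma exchange_value_ge:
  assumes "q \<in> feasible_plans x y u qbar G \<omega>"
  shows "total_expenditure u p q - total_expenditure u p qbar \<le> exchange_value x y u p qbar G \<omega>"
proof -
  obtain q0 where q0: "q0 \<in> feasible_plans x y u qbar G \<omega>"
    and max: "\<And>q. q \<in> feasible_plans x y u qbar G \<omega> \<Longrightarrow>
      total_expenditure u p q \<le> total_expenditure u p q0"
    using continuous_attains_sup[OF compact_feasible_plans _ continuous_on_total_expenditure] assms
    by blast
  have "(GREATEST s. \<exists>q\<in>feasible_plans x y u qbar G \<omega>. s = total_expenditure u p q) =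
      total_expenditure u p q0"
    using q0 max by (intro Greatest_equality) auto
  then show ?thesis
    using max[OF assms] by (simp add: exchange_value_def)
qed

text \<open>Along the ray through \<open>column j qbar\<close> utility grows like
  \<open>c powr \<beta> j\<close>, so the ray meets this positive utility level only once.\<close>

lemma not_collinear_of_utility_eq:
  assumes q: "q \<in> orthant" "u j q = u j (column j qbar)" "q \<noteq> column j qbar"
  shows "\<not> collinear {0, q, column j qbar}"
proof
  let ?b = "column j qbar"
  assume "collinear {0, q, ?b}"
  then have "collinear {0, ?b, q}"
    by (simp add: insert_commute)
  moreover have zero: "u j 0 = 0"
    by (rule homogeneous_zero[OF u_homogeneous degree_pos])
  then have nz: "q \<noteq> 0" "?b \<noteq> 0"
    using utility_qbar_pos[of j] q by auto
  ultimately obtain c where c: "q = c *\<^sub>R ?b"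
    by (auto simp: collinear_lemma)
  have b: "?b \<in> orthant"
    by (rule column_in_orthant[OF prob_matrix_qbar])
  \<comment> \<open>A nonzero coordinate of \<open>column j qbar\<close> is positive, which forces
    \<open>0 \<le> c\<close>; then \<open>q \<noteq> 0\<close> gives \<open>0 < c\<close>.\<close>
  obtain i where "?b $ i \<noteq> 0"
    using nz by (auto simp: vec_eq_iff)
  then have "0 < ?b $ i" "0 \<le> c * ?b $ i"
    using b q(1) c by (auto simp: orthant_def order_less_le)
  then have "0 < c"
    using nz c by (auto simp: zero_le_mult_iff order_less_le)
  then have "u j ?b = c powr \<beta> j * u j ?b"
    using u_homogeneous[of j] b q(2) c by (simp add: homogeneous_def)
  then have "c powr \<beta> j = 1"
    using utility_qbar_pos[of j] by simp
  then have "c = 1"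
    using \<open>0 < c\<close> degree_pos[of j] by (simp add: powr_def)
  then show False
    using c q(3) by simp
qed

end

section \<open>Positive exchange value and uniqueness of the feasible plan\<close>

theorem proposition3p7:
  fixes X :: "(real^'m) set"
    and x :: "'k::finite \<Rightarrow> real^'m"
    and y :: "'l::finite \<Rightarrow> real^'m"
    and u :: "'l \<Rightarrow> real^'k \<Rightarrow> real"
    and w :: "'l \<Rightarrow> real"
    and p :: "'l \<Rightarrow> real^'k"
    and qbar :: "real^'l^'k"
    and \<beta> :: "'l \<Rightarrow> real"
    and G :: "(real^'m) pair_pre_digraph"
    and \<omega> :: "(real^'m) \<times> (real^'m) \<Rightarrow> real"
  assumes "economy X x y u w p qbar"
    and "\<And>j. 0 < \<beta> j"
    and "\<And>j. homogeneous (\<beta> j) (u j)"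
    and "\<And>j. concave_on orthant (\<lambda>q. u j q powr (1 / \<beta> j))"
    and "\<And>j l q q'. 0 < l \<Longrightarrow> l < 1 \<Longrightarrow> q \<in> orthant \<Longrightarrow> q' \<in> orthant \<Longrightarrow> \<not> collinear {0, q, q'} \<Longrightarrow>
           u j ((1 - l) *\<^sub>R q + l *\<^sub>R q') powr (1 / \<beta> j)
             > (1 - l) * u j q powr (1 / \<beta> j) + l * u j q' powr (1 / \<beta> j)"
    and "(G, \<omega>) \<in> transport_paths X x y qbar"
  shows "exchange_value x y u p qbar G \<omega> > 0 \<longleftrightarrow> feasible_plans x y u qbar G \<omega> \<noteq> {qbar}"
proof -
  interpret homogeneous_economy X x y u w p qbar \<beta>
    using assms(1-3) by (simp add: homogeneous_economy_def homogeneous_economy_axioms_def)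
  let ?F = "feasible_plans x y u qbar G \<omega>"
  have qbar: "qbar \<in> ?F"
    using assms(6) prob_matrix_qbar by (simp add: feasible_plans_def transport_paths_def)
  show ?thesis
  proof
    assume "exchange_value x y u p qbar G \<omega> > 0"
    then show "?F \<noteq> {qbar}"
      \<comment> \<open>If \<open>qbar\<close> were the only feasible plan, the maximum would be its
        own expenditure and the difference 0.\<close>
      by (auto simp: exchange_value_def Greatest_equality)
  next
    assume "?F \<noteq> {qbar}"
    then obtain q where q: "q \<in> ?F" "q \<noteq> qbar"
      using qbar by auto
    have "\<exists>r\<in>?F. \<exists>j. u j (column j qbar) < u j (column j r)"
    proof (cases "\<exists>j. u j (column j qbar) < u j (column j q)")
      case True
      then show ?thesis
        using q by auto
    next
      case False
      then have eq: "u j (column j q) = u j (column j qbar)" for j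
        using q by (auto simp: feasible_plans_def intro: antisym simp: not_less)
      obtain j where j: "column j q \<noteq> column j qbar"
        using q(2) by (auto simp: column_def vec_eq_iff)
      have orth: "column j q \<in> orthant" "column j qbar \<in> orthant"
        using q qbar by (auto simp: feasible_plans_def intro: column_in_orthant)
      define r where "r = (1/2) *\<^sub>R q + (1/2) *\<^sub>R qbar"
      have r: "r \<in> ?F"
        unfolding r_def by (rule convexD[OF convex_feasible_plans q(1) qbar]) auto
      have col: "column j r = (1 - 1/2) *\<^sub>R column j q + (1/2) *\<^sub>R column j qbar"
        by (simp add: r_def column_def vec_eq_iff)
      \<comment> \<open>Both end points have the same utility, so the convex combination in the
        strict concavity inequality collapses to the left side.\<close>
      have "u j (column j qbar) powr (1 / \<beta> j) < u j (column j r) powr (1 / \<beta> j)"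
        unfolding col
        using assms(5)[of "1/2" "column j q" "column j qbar" j] orth eq[of j]
          not_collinear_of_utility_eq[OF orth(1) eq j]
        by simp
      \<comment> \<open>Feasibility of \<open>r\<close> supplies the order; the inequality of powers
        then only has to exclude equality.\<close>
      moreover have "u j (column j qbar) \<le> u j (column j r)"
        using r by (simp add: feasible_plans_def)
      ultimately show ?thesis
        using r by (intro bexI[of _ r] exI[of _ j]) (auto simp: order_less_le)
    qed
    then obtain r j where "r \<in> ?F" "u j (column j qbar) < u j (column j r)"
      by auto
    then show "exchange_value x y u p qbar G \<omega> > 0"
      using total_expenditure_greater exchange_value_ge by fastforce
  qed
qed

end
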